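(* Let $n,m\in\mathbb{N}$. Let $W_{\mathrm{EN}},W_{\mathrm{P}},W_{\mathrm{D}}\in\mathbb{R}^{nm\times nm}$ be diagonal positive semidefinite matrices, $W_{\mathrm{EX}}\in\mathbb{R}^{nm\times nm}$ a diagonal positive definite matrix, $\alpha_{\mathrm{F}}\ge 0$, and let $L_u\in\mathbb{R}^{nm\times nm}$ be the symmetrized-graph Laplacian lifted to $m$ topics (see context). Put $$Q:=W_{\mathrm{D}}+W_{\mathrm{P}},\qquad N:=-\tfrac12 W_{\mathrm{EN}},\qquad R:=W_{\mathrm{EX}}+\alpha_{\mathrm{F}}L_u,\qquad \widetilde Q:=Q-NR^{-1}N,$$ and, for $x,v\in\mathbb{R}^{nm}$, $$\widetilde\ell_{sq}(x,v):=x^\top\widetilde Q x+v^\top R v .$$ If $$\lambda_{m,\mathrm{D}}+\lambda_{m,\mathrm{P}}>\frac{\lambda_{M,\mathrm{EN}}^2}{4\lambda_{m,\mathrm{EX}}},$$ then the block matrix $\begin{bmatrix}\widetilde Q& O_{nm}\\ O_{nm}&R\end{bmatrix}$, and thus the quadratic form $\widetilde\ell_{sq}$, is positive definite.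
   Context: For $(\cdot)\in\{\mathrm{D},\mathrm{P},\mathrm{EN},\mathrm{EX}\}$ and $W_{(\cdot)}=\mathrm{diag}(w_{(\cdot),1},\dots,w_{(\cdot),nm})$, write $\lambda_{m,(\cdot)}:=\min_i w_{(\cdot),i}$ and $\lambda_{M,(\cdot)}:=\max_i w_{(\cdot),i}$ (the subscripts $m$ and $M$ here stand for minimum and maximum). Let $\Gamma\in\mathbb{R}^{n\times n}$ be the adjacency matrix, with nonnegative entries, of a connected directed weighted graph on $n$ vertices (connected meaning that the underlying undirected graph is connected). Set $\Gamma_b:=\tfrac12(\Gamma+\Gamma^\top)$, $\Delta_b:=\mathrm{diag}(\Gamma_b\mathbf{1}_n)$, $L_b:=\Delta_b-\Gamma_b$, and $L_u:=I_m\otimes L_b$, where $\mathbf{1}_n$ is the vector of ones, $I_m$ is the $m\times m$ identity matrix and $\otimes$ is the Kronecker product. $O_{nm}$ denotes the $nm\times nm$ zero matrix. Under these assumptions $R$ is symmetric positive definite, hence invertible. *)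

theory Defs
  imports "Graph_Theory.Digraph_Component" "HOL-Analysis.Analysis"
begin

definition diag :: "real^'k \<Rightarrow> real^'k^'k" where
  "diag w = (\<chi> i j. if i = j then w $ i else 0)"

definition min_entry :: "real^'k \<Rightarrow> real" where
  "min_entry w = Min (range (\<lambda>i. w $ i))"

definition max_entry :: "real^'k \<Rightarrow> real" where
  "max_entry w = Max (range (\<lambda>i. w $ i))"

definition positive_semidefinite :: "real^'k^'k \<Rightarrow> bool" where
  "positive_semidefinite A \<longleftrightarrow> transpose A = A \<and> (\<forall>x. 0 \<le> x \<bullet> (A *v x))"

definition positive_definite :: "real^'k^'k \<Rightarrow> bool" where
  "positive_definite A \<longleftrightarrow> transpose A = A \<and> (\<forall>x. x \<noteq> 0 \<longrightarrow> 0 < x \<bullet> (A *v x))"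

text \<open>
  Rows and columns of a Kronecker product are indexed by pairs. For index types of sizes
  \<open>m\<close> and \<open>n\<close>, the pair \<open>(a, i)\<close> plays the role of position \<open>(a - 1) n + i\<close> in
  \<open>{1, ..., n m}\<close>.
\<close>

definition kronecker :: "real^'m^'m \<Rightarrow> real^'n^'n \<Rightarrow> real^('m \<times> 'n)^('m \<times> 'n)"
  (infixl "\<otimes>\<^sub>K" 70) where
  "A \<otimes>\<^sub>K B = (\<chi> p q. A $ fst p $ fst q * B $ snd p $ snd q)"

definition block_matrix ::
  "real^'k^'k \<Rightarrow> real^'l^'k \<Rightarrow> real^'k^'l \<Rightarrow> real^'l^'l \<Rightarrow> real^('k + 'l)^('k + 'l)" where
  "block_matrix A B C D = (\<chi> p q.
     (case p of
        Inl i \<Rightarrow> (case q of Inl j \<Rightarrow> A $ i $ j | Inr j \<Rightarrow> B $ i $ j)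
      | Inr i \<Rightarrow> (case q of Inl j \<Rightarrow> C $ i $ j | Inr j \<Rightarrow> D $ i $ j)))"

text \<open>
  The weighted digraph with adjacency matrix \<open>G\<close> has an arc \<open>(i, j)\<close> exactly where the entry
  is nonzero. Self-loops are allowed; they do not affect the Laplacian. Connectedness
  (\<open>Digraph_Component.connected\<close>, not the topological notion of the same base name) is that of
  the underlying undirected graph.
\<close>

definition digraph_of :: "real^'n^'n \<Rightarrow> ('n, 'n \<times> 'n) pre_digraph" where
  "digraph_of G =
     \<lparr> verts = UNIV, arcs = {(i, j). G $ i $ j \<noteq> 0}, tail = fst, head = snd \<rparr>"

definition connected_weighted_digraph :: "real^'n^'n \<Rightarrow> bool" where
  "connected_weighted_digraph G \<longleftrightarrow>
     (\<forall>i j. 0 \<le> G $ i $ j) \<and> Digraph_Component.connected (digraph_of G)"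

definition symmetrized :: "real^'n^'n \<Rightarrow> real^'n^'n" where
  "symmetrized G = (1/2) *\<^sub>R (G + transpose G)"

text \<open>The \<open>1\<close> below is the all-ones vector.\<close>

definition sym_laplacian :: "real^'n^'n \<Rightarrow> real^'n^'n" where
  "sym_laplacian G = diag (symmetrized G *v 1) - symmetrized G"

end

theory Submission
  imports Defs
begin

text \<open>
  Put \<open>\<lambda> = \<lambda>\<^sub>m\<^sub>,\<^sub>E\<^sub>X\<close>. The Laplacian form is
  \<open>\<onehalf> \<Sum> g\<^sub>i\<^sub>j (x\<^sub>i - x\<^sub>j)\<^sup>2 \<ge> 0\<close>, so \<open>R\<close> is symmetric with
  \<open>y \<bullet> R y \<ge> \<lambda> \<parallel>y\<parallel>\<^sup>2\<close>. Taking \<open>y = R\<^sup>-\<^sup>1 z\<close> and using the Cauchy-Schwarz inequality gives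
  \<open>z \<bullet> R\<^sup>-\<^sup>1 z \<le> \<parallel>z\<parallel>\<^sup>2 / \<lambda>\<close>. With \<open>z = N x\<close> the correction term of \<open>Qt\<close> is at most
  \<open>\<lambda>\<^sub>M\<^sub>,\<^sub>E\<^sub>N\<^sup>2 \<parallel>x\<parallel>\<^sup>2 / (4 \<lambda>)\<close>, which the gap condition makes smaller than \<open>x \<bullet> Q x\<close>.
\<close>

section \<open>Transposes and symmetric matrices\<close>

lemma transpose_add: "transpose (A + B) = transpose A + transpose (B :: real^'n^'m)"
  by (simp add: transpose_def vec_eq_iff)

lemma transpose_diff: "transpose (A - B) = transpose A - transpose (B :: real^'n^'m)"
  by (simp add: transpose_def vec_eq_iff)

lemma transpose_minus: "transpose (- A) = - transpose (A :: real^'n^'m)"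
  by (simp add: transpose_def vec_eq_iff)

lemma inner_symmetric_matrix:
  fixes A :: "real^'k^'k"
  assumes "transpose A = A"
  shows "x \<bullet> (A *v y) = (A *v x) \<bullet> y"
  by (metis assms dot_lmul_matrix transpose_matrix_vector)

section \<open>Diagonal matrices and their extreme entries\<close>

lemma diag_mult_vec_nth: "(diag w *v x) $ i = w $ i * x $ i"
  by (simp add: diag_def matrix_vector_mult_def if_distrib if_distribR cong: if_cong)

lemma transpose_diag: "transpose (diag w) = diag w"
  by (auto simp: transpose_def diag_def vec_eq_iff)

lemma inner_diag: "x \<bullet> (diag w *v x) = (\<Sum>i\<in>UNIV. w $ i * (x $ i)\<^sup>2)"
  by (simp add: inner_vec_def diag_mult_vec_nth power2_eq_square mult_ac)

text \<open>Testing the form on a basis vector isolates one diagonal entry, so definiteness of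
  \<open>diag w\<close> becomes a sign condition on \<open>w\<close>.\<close>

lemma inner_axis_diag: "axis i 1 \<bullet> (diag w *v axis i 1) = w $ i"
  by (simp add: inner_axis' diag_mult_vec_nth)

lemma positive_semidefinite_diag_nonneg:
  assumes "positive_semidefinite (diag w)"
  shows "0 \<le> w $ i"
  using assms unfolding positive_semidefinite_def by (metis inner_axis_diag)

lemma positive_definite_diag_pos:
  assumes "positive_definite (diag w)"
  shows "0 < w $ i"
proof -
  have "axis i (1::real) \<noteq> 0" by (simp add: axis_eq_0_iff)
  with assms show ?thesis unfolding positive_definite_def by (metis inner_axis_diag)
qed

lemma min_entry_le: "min_entry w \<le> w $ i"
  by (simp add: min_entry_def)

lemma max_entry_ge: "w $ i \<le> max_entry w"
  by (simp add: max_entry_def)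

lemma min_entry_pos:
  assumes "\<And>i. 0 < w $ i"
  shows "0 < min_entry w"
  using assms by (auto simp: min_entry_def)

lemma norm_vec_square: "(norm x)\<^sup>2 = (\<Sum>i\<in>UNIV. (x $ i)\<^sup>2)" for x :: "real^'k"
  unfolding power2_norm_eq_inner inner_vec_def by (simp add: power2_eq_square)

lemma inner_diag_ge: "min_entry w * (norm x)\<^sup>2 \<le> x \<bullet> (diag w *v x)"
  unfolding inner_diag norm_vec_square sum_distrib_left
  by (intro sum_mono mult_right_mono min_entry_le) simp

text \<open>Nonnegative entries allow \<open>w $ i \<le> max_entry w\<close> to be squared.\<close>

lemma norm_diag_mult_vec_le:
  assumes "\<And>i. 0 \<le> w $ i"
  shows "(norm (diag w *v x))\<^sup>2 \<le> (max_entry w)\<^sup>2 * (norm x)\<^sup>2"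
  unfolding norm_vec_square sum_distrib_left diag_mult_vec_nth power_mult_distrib
  by (intro sum_mono mult_right_mono power_mono max_entry_ge assms) simp

section \<open>Quadratic form of the graph Laplacian\<close>

lemma transpose_symmetrized: "transpose (symmetrized G) = symmetrized G"
  by (simp add: symmetrized_def transpose_def vec_eq_iff add_ac)

lemma transpose_sym_laplacian: "transpose (sym_laplacian G) = sym_laplacian G"
  by (simp add: sym_laplacian_def transpose_diff transpose_diag transpose_symmetrized)

text \<open>Expanding the square gives the degree term twice and the adjacency term with factor -2;
  halving leaves their difference. Since all weights are nonnegative for a weighted digraph,
  semidefiniteness can be read off.\<close>

lemma inner_sym_laplacian:
  "x \<bullet> (sym_laplacian G *v x) =
     (\<Sum>i\<in>UNIV. \<Sum>j\<in>UNIV. symmetrized G $ i $ j * (x $ i - x $ j)\<^sup>2) / 2"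
proof -
  define S where "S = symmetrized G"
  have sym: "S $ i $ j = S $ j $ i" for i j
    by (simp add: S_def symmetrized_def transpose_def)
  have deg: "x \<bullet> (diag (S *v 1) *v x) = (\<Sum>i\<in>UNIV. \<Sum>j\<in>UNIV. S $ i $ j * (x $ i)\<^sup>2)"
    unfolding inner_diag by (simp add: matrix_vector_mult_def sum_distrib_right)
  \<comment> \<open>Swapping the sums and using symmetry of \<open>S\<close> turns row degrees into
    column degrees, so both squares carry the same total.\<close>
  have deg': "\<dots> = (\<Sum>i\<in>UNIV. \<Sum>j\<in>UNIV. S $ i $ j * (x $ j)\<^sup>2)"
    by (subst sum.swap) (simp add: sym)
  have adj: "x \<bullet> (S *v x) = (\<Sum>i\<in>UNIV. \<Sum>j\<in>UNIV. S $ i $ j * (x $ i * x $ j))"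
    by (simp add: inner_vec_def matrix_vector_mult_def sum_distrib_left mult_ac)
  have "(\<Sum>i\<in>UNIV. \<Sum>j\<in>UNIV. S $ i $ j * (x $ i - x $ j)\<^sup>2) =
      (\<Sum>i\<in>UNIV. \<Sum>j\<in>UNIV. S $ i $ j * (x $ i)\<^sup>2) + (\<Sum>i\<in>UNIV. \<Sum>j\<in>UNIV. S $ i $ j * (x $ j)\<^sup>2)
      - 2 * (\<Sum>i\<in>UNIV. \<Sum>j\<in>UNIV. S $ i $ j * (x $ i * x $ j))"
    by (simp add: power2_diff algebra_simps sum.distrib sum_subtractf sum_distrib_left)
  then show ?thesis
    using deg deg' adj
    by (simp add: sym_laplacian_def matrix_vector_mult_diff_rdistrib inner_diff_right S_def)
qed

lemma sym_laplacian_positive_semidefinite: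
  assumes "\<And>i j. 0 \<le> G $ i $ j"
  shows "positive_semidefinite (sym_laplacian G)"
proof -
  have "0 \<le> symmetrized G $ i $ j" for i j
    by (simp add: symmetrized_def transpose_def assms)
  then show ?thesis
    unfolding positive_semidefinite_def inner_sym_laplacian
    by (auto simp: transpose_sym_laplacian intro!: sum_nonneg)
qed

section \<open>Lifting to several topics by a Kronecker product\<close>

lemma inner_kronecker_mat_1:
  fixes B :: "real^'n::finite^'n" and x :: "real^('m::finite \<times> 'n::finite)"
  shows "x \<bullet> (((mat 1 :: real^'m^'m) \<otimes>\<^sub>K B) *v x) =
    (\<Sum>a\<in>UNIV. (\<chi> i. x $ (a, i)) \<bullet> (B *v (\<chi> i. x $ (a, i))))"
proof -
  \<comment> \<open>The identity factor makes the product block diagonal: each slice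
    \<open>a\<close> is acted on by its own copy of \<open>B\<close>.\<close>
  have row: "(((mat 1 :: real^'m^'m) \<otimes>\<^sub>K B) *v x) $ (a, i) = (B *v (\<chi> i. x $ (a, i))) $ i" for a i
  proof -
    have "(((mat 1 :: real^'m^'m) \<otimes>\<^sub>K B) *v x) $ (a, i) =
        (\<Sum>b\<in>UNIV. \<Sum>j\<in>UNIV. (if a = b then 1 else 0) * B $ i $ j * x $ (b, j))"
      by (simp add: matrix_vector_mult_def kronecker_def mat_def sum.cartesian_product
          case_prod_unfold flip: UNIV_Times_UNIV)
    also have "\<dots> = (\<Sum>b\<in>UNIV. if a = b then \<Sum>j\<in>UNIV. B $ i $ j * x $ (b, j) else 0)"
      by (intro sum.cong) auto
    finally show ?thesis by (simp add: matrix_vector_mult_def)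
  qed
  \<comment> \<open>Read from right to left, \<open>row\<close> turns the slices back into entries
    of the product; both sides are then sums over all pairs.\<close>
  show ?thesis
    unfolding inner_vec_def
    by (simp add: sum.cartesian_product case_prod_unfold flip: UNIV_Times_UNIV row)
qed

lemma transpose_kronecker: "transpose (A \<otimes>\<^sub>K B) = transpose A \<otimes>\<^sub>K transpose B"
  by (simp add: transpose_def kronecker_def vec_eq_iff)

lemma kronecker_mat_1_positive_semidefinite:
  assumes "positive_semidefinite B"
  shows "positive_semidefinite ((mat 1 :: real^'m^'m) \<otimes>\<^sub>K B)"
  using assms unfolding positive_semidefinite_def inner_kronecker_mat_1
  by (simp add: transpose_kronecker sum_nonneg)

section \<open>Inverses and their quadratic forms\<close>

lemma positive_definite_invertible:
  assumes "positive_definite A"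
  shows "invertible A"
proof -
  have "x = 0" if "A *v x = 0" for x
    using assms that unfolding positive_definite_def by (metis inner_zero_right less_irrefl)
  then show ?thesis
    using invertible_left_inverse matrix_left_invertible_ker by blast
qed

text \<open>\<open>matrix_inv\<close> is defined by choice, so both identities come from the
  existence of a two-sided inverse.\<close>

lemma matrix_inv:
  assumes "invertible A"
  shows "A ** matrix_inv A = mat 1" "matrix_inv A ** A = mat 1"
  using someI_ex[OF assms[unfolded invertible_def]] by (simp_all add: matrix_inv_def)

lemma matrix_inv_unique:
  fixes A :: "real^'k^'k"
  assumes "A ** B = mat 1"
  shows "matrix_inv A = B"
proof -
  have "invertible A" using assms invertible_right_inverse by blast
  then have "B = matrix_inv A ** (A ** B)"
    by (simp add: matrix_mul_assoc matrix_inv)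
  with assms show ?thesis by simp
qed

text \<open>For symmetric \<open>A\<close> this makes the inverse symmetric, from which symmetry of
  \<open>Qt\<close> follows.\<close>

lemma transpose_matrix_inv:
  fixes A :: "real^'k^'k"
  assumes "invertible A"
  shows "transpose (matrix_inv A) = matrix_inv (transpose A)"
proof -
  have "transpose A ** transpose (matrix_inv A) = mat 1"
    using assms by (simp add: matrix_inv flip: matrix_transpose_mul)
  then show ?thesis by (metis matrix_inv_unique)
qed

lemma inner_matrix_inv_le:
  fixes A :: "real^'k^'k"
  assumes "invertible A" and "0 < c" and coercive: "\<And>y. c * (norm y)\<^sup>2 \<le> y \<bullet> (A *v y)"
  shows "z \<bullet> (matrix_inv A *v z) \<le> (norm z)\<^sup>2 / c"
proof -
  define y where "y = matrix_inv A *v z"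
  have "A *v y = z"
    using assms(1) by (simp add: y_def matrix_vector_mul_assoc matrix_inv)
  with coercive[of y] have "c * (norm y)\<^sup>2 \<le> norm y * norm z"
    using norm_cauchy_schwarz[of y z] by simp
  \<comment> \<open>One factor \<open>norm y\<close> cancels unless \<open>y = 0\<close>, where the
    bound is trivial.\<close>
  then have "c * norm y \<le> norm z"
    by (cases "y = 0") (simp_all add: power2_eq_square mult_ac)
  then have "norm y \<le> norm z / c"
    using \<open>0 < c\<close> by (simp add: pos_le_divide_eq mult_ac)
  then have "norm z * norm y \<le> norm z * (norm z / c)"
    by (intro mult_left_mono) auto
  then show ?thesis
    using norm_cauchy_schwarz[of z y] by (simp add: y_def power2_eq_square)
qed

section \<open>Block-diagonal matrices\<close>

lemma sum_UNIV_Plus: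
  "(\<Sum>p\<in>UNIV. f p) = (\<Sum>i\<in>UNIV. f (Inl i)) + (\<Sum>j\<in>UNIV. f (Inr j))"
  for f :: "'a::finite + 'b::finite \<Rightarrow> real"
  by (simp add: sum.Plus comp_def flip: UNIV_Plus_UNIV)

lemma inner_block_diagonal:
  "z \<bullet> (block_matrix A 0 0 D *v z) =
     (\<chi> i. z $ Inl i) \<bullet> (A *v (\<chi> i. z $ Inl i)) + (\<chi> j. z $ Inr j) \<bullet> (D *v (\<chi> j. z $ Inr j))"
  by (simp add: inner_vec_def matrix_vector_mult_def sum_UNIV_Plus block_matrix_def)

text \<open>A nonzero vector has a nonzero half, which contributes strictly, while the other half
  contributes at least zero.\<close>

lemma block_diagonal_positive_definite:
  assumes "positive_definite A" "positive_definite D"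
  shows "positive_definite (block_matrix A 0 0 D)"
  unfolding positive_definite_def
proof (intro conjI allI impI)
  have "A $ i $ j = A $ j $ i" "D $ k $ l = D $ l $ k" for i j k l
    using assms unfolding positive_definite_def transpose_def by (metis vec_lambda_beta)+
  then show "transpose (block_matrix A 0 0 D) = block_matrix A 0 0 D"
    by (auto simp: transpose_def block_matrix_def vec_eq_iff split: sum.splits)
next
  fix z :: "real^('a + 'b)"
  assume "z \<noteq> 0"
  define x v where "x = (\<chi> i. z $ Inl i)" and "v = (\<chi> j. z $ Inr j)"
  have "x \<noteq> 0 \<or> v \<noteq> 0"
  proof (rule ccontr)
    assume "\<not> ?thesis"
    then have "z $ p = 0" for p
      by (cases p) (auto simp: x_def v_def vec_eq_iff)
    with \<open>z \<noteq> 0\<close> show False by (simp add: vec_eq_iff)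
  qed
  then have "0 < x \<bullet> (A *v x) + v \<bullet> (D *v v)"
    using assms unfolding positive_definite_def
    by (metis add.right_neutral add_0 add_pos_pos inner_zero_left)
  then show "0 < z \<bullet> (block_matrix A 0 0 D *v z)"
    by (simp add: inner_block_diagonal x_def v_def)
qed

theorem lemma3:
  fixes \<Gamma> :: "real^'n::finite^'n"
    and w_EN w_P w_D w_EX :: "real^('m::finite \<times> 'n::finite)"
    and W_EN W_P W_D W_EX L_u Q N R Qt :: "real^('m \<times> 'n)^('m \<times> 'n)"
    and \<alpha>_F :: real
    and l_sq :: "real^('m \<times> 'n) \<Rightarrow> real^('m \<times> 'n) \<Rightarrow> real"
  assumes graph: "connected_weighted_digraph \<Gamma>"
    and L_u: "L_u = (mat 1 :: real^'m^'m) \<otimes>\<^sub>K sym_laplacian \<Gamma>"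
    and W_EN: "W_EN = diag w_EN" "positive_semidefinite W_EN"
    and W_P: "W_P = diag w_P" "positive_semidefinite W_P"
    and W_D: "W_D = diag w_D" "positive_semidefinite W_D"
    and W_EX: "W_EX = diag w_EX" "positive_definite W_EX"
    and \<alpha>_F: "0 \<le> \<alpha>_F"
    and Q: "Q = W_D + W_P"
    and N: "N = - ((1/2) *\<^sub>R W_EN)"
    and R: "R = W_EX + \<alpha>_F *\<^sub>R L_u"
    and Qt: "Qt = Q - N ** matrix_inv R ** N"
    and l_sq: "\<And>x v. l_sq x v = x \<bullet> (Qt *v x) + v \<bullet> (R *v v)"
    and gap: "min_entry w_D + min_entry w_P > (max_entry w_EN)\<^sup>2 / (4 * min_entry w_EX)"
  shows "positive_definite (block_matrix Qt 0 0 R) \<and>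
         (\<forall>x v. (x, v) \<noteq> (0, 0) \<longrightarrow> l_sq x v > 0)"
proof -
  \<comment> \<open>This is the coercivity constant of \<open>R\<close>: the Laplacian part only
    adds a nonnegative amount to the form of \<open>W_EX\<close>.\<close>
  define c where "c = min_entry w_EX"
  have "0 < c"
    unfolding c_def using W_EX min_entry_pos positive_definite_diag_pos by metis
  have Lu: "positive_semidefinite L_u"
    using graph unfolding L_u connected_weighted_digraph_def
    by (intro kronecker_mat_1_positive_semidefinite sym_laplacian_positive_semidefinite) auto
  have Rc: "c * (norm y)\<^sup>2 \<le> y \<bullet> (R *v y)" for y
  proof -
    have "0 \<le> \<alpha>_F * (y \<bullet> (L_u *v y))"
      using Lu \<alpha>_F by (simp add: positive_semidefinite_def)
    with inner_diag_ge[of w_EX y] show ?thesis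
      by (simp add: R W_EX(1) c_def matrix_vector_mult_add_rdistrib inner_add_right
          flip: scaleR_matrix_vector_assoc)
  qed
  have Rt: "transpose R = R"
    using Lu by (simp add: R W_EX(1) positive_semidefinite_def transpose_add transpose_diag
        transpose_scalar)
  have Rpd: "positive_definite R"
    unfolding positive_definite_def
  proof (intro conjI allI impI Rt)
    fix y :: "real^('m \<times> 'n)"
    assume "y \<noteq> 0"
    then have "0 < c * (norm y)\<^sup>2" using \<open>0 < c\<close> by simp
    with Rc show "0 < y \<bullet> (R *v y)" by (rule order.strict_trans2[rotated])
  qed
  then have Rinv: "invertible R" by (rule positive_definite_invertible)
  have Nt: "transpose N = N"
    by (simp add: N W_EN(1) transpose_minus transpose_scalar transpose_diag)
  have "transpose Q = Q"
    by (simp add: Q W_D(1) W_P(1) transpose_add transpose_diag)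
  then have Qtt: "transpose Qt = Qt"
    by (simp add: Qt transpose_diff matrix_transpose_mul Nt transpose_matrix_inv[OF Rinv] Rt
        matrix_mul_assoc)
  have "0 < x \<bullet> (Qt *v x)" if "x \<noteq> 0" for x
  proof -
    have "N *v x = - ((1/2) *\<^sub>R (diag w_EN *v x))"
      by (simp add: N W_EN(1) vec_eq_iff matrix_vector_mult_def sum_negf sum_distrib_left
          sum_divide_distrib)
    \<comment> \<open>Squaring the factor 1/2 in \<open>N\<close> produces the 4 in the gap
      condition.\<close>
    then have "(norm (N *v x))\<^sup>2 = (norm (diag w_EN *v x))\<^sup>2 / 4"
      by (simp add: power_divide)
    also have "\<dots> \<le> (max_entry w_EN)\<^sup>2 * (norm x)\<^sup>2 / 4"
      using norm_diag_mult_vec_le[of w_EN x] W_EN positive_semidefinite_diag_nonneg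
      by (intro divide_right_mono) auto
    finally have Nx: "(norm (N *v x))\<^sup>2 / c \<le> (max_entry w_EN)\<^sup>2 / (4 * c) * (norm x)\<^sup>2"
      using \<open>0 < c\<close> by (simp add: field_simps)
    \<comment> \<open>Symmetry of \<open>N\<close> moves its left copy to the other argument,
      leaving the form of the inverse at \<open>N *v x\<close>.\<close>
    have "x \<bullet> ((N ** matrix_inv R ** N) *v x) = (N *v x) \<bullet> (matrix_inv R *v (N *v x))"
      by (simp add: inner_symmetric_matrix[OF Nt] flip: matrix_vector_mul_assoc)
    also have "\<dots> \<le> (norm (N *v x))\<^sup>2 / c"
      using inner_matrix_inv_le[OF Rinv \<open>0 < c\<close> Rc] .
    also note Nx
    \<comment> \<open>Strictness enters here: the gap is strict and \<open>norm x\<close> is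
      positive.\<close>
    also have "(max_entry w_EN)\<^sup>2 / (4 * c) * (norm x)\<^sup>2 <
        (min_entry w_D + min_entry w_P) * (norm x)\<^sup>2"
      using gap that by (intro mult_strict_right_mono) (auto simp: c_def)
    also have "\<dots> \<le> x \<bullet> (Q *v x)"
      using inner_diag_ge[of w_D x] inner_diag_ge[of w_P x]
      by (simp add: Q W_D(1) W_P(1) matrix_vector_mult_add_rdistrib inner_add_right distrib_right)
    finally show ?thesis
      by (simp add: Qt matrix_vector_mult_diff_rdistrib inner_diff_right)
  qed
  with Qtt have Qpd: "positive_definite Qt"
    by (simp add: positive_definite_def)
  have "0 < l_sq x v" if "(x, v) \<noteq> (0, 0)" for x v
    using that Qpd Rpd unfolding l_sq positive_definite_def
    by (metis add.right_neutral add_0 add_pos_pos inner_zero_left)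
  with block_diagonal_positive_definite[OF Qpd Rpd] show ?thesis by blast
qed

end
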